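(* Let $\mathcal{D}=\bigcap_{l\in\mathrm{clq}(G)}\{x\in\mathbb{R}^{nd}:x_{\mathcal{C}_l}\in\mathcal{D}_l\}$ be a non-empty closed convex set and let $T:\mathbb{R}^{nd}\to\mathbb{R}^{nd}$ be the clique-based projection onto $\mathcal{D}$. Then: (a) $T$ is nonexpansive, i.e. $\|T(x)-T(y)\|\le\|x-y\|$ for all $x,y\in\mathbb{R}^{nd}$. (b) The fixed point set $\mathrm{Fix}(T)=\{x\in\mathbb{R}^{nd}:T(x)=x\}$ satisfies $\mathrm{Fix}(T)=\mathcal{D}$. (c) For any $x\in\mathbb{R}^{nd}\setminus\mathcal{D}$ and any $z\in\mathcal{D}$, $\|T(x)-z\|<\|x-z\|$. (d) For any $x\in\mathbb{R}^{nd}$, the limit $T^\infty(x)=\lim_{p\to\infty}T^p(x)$ exists and belongs to $\mathcal{D}$, where $T^p$ is the $p$-fold composition of $T$.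
   Context: $\|\cdot\|$ is the Euclidean norm, and for a symmetric positive definite $Q$, $\|v\|_Q=\sqrt{v^\top Qv}$. $G=(\mathcal{N},\mathcal{E})$ is an undirected graph with $\mathcal{N}=\{1,\ldots,n\}$. A clique is a subset of $\mathcal{N}$ inducing a complete subgraph; it is maximal if it is not contained in any other clique. $\mathrm{clq}(G)=\{1,\ldots,q\}$ indexes the maximal cliques $\mathcal{C}_1,\ldots,\mathcal{C}_q$ of $G$, and $\mathrm{clq}_i(G)=\{l\in\mathrm{clq}(G):i\in\mathcal{C}_l\}$. Vectors $x\in\mathbb{R}^{nd}$ are written $x=[x_1^\top,\ldots,x_n^\top]^\top$ with $x_i\in\mathbb{R}^d$; for $\mathcal{C}=\{j_1<\cdots<j_{|\mathcal{C}|}\}\subset\mathcal{N}$, $x_{\mathcal{C}}=[x_{j_1}^\top,\ldots,x_{j_{|\mathcal{C}|}}^\top]^\top$. For each $l\in\mathrm{clq}(G)$, $\mathcal{D}_l\subset\mathbb{R}^{|\mathcal{C}_l|d}$ is a non-empty closed convex set. Let $\gamma=[1/|\mathrm{clq}_1(G)|,\ldots,1/|\mathrm{clq}_n(G)|]^\top\otimes\mathbf{1}_d\in\mathbb{R}^{nd}$, where $\mathbf{1}_d$ is the all-ones vector (so $\mathrm{diag}(\gamma_{\mathcal{C}_l})$ is the block-diagonal matrix with blocks $\frac{1}{|\mathrm{clq}_i(G)|}I_d$, $i\in\mathcal{C}_l$). Let $P_{\mathcal{D}_l}(x_{\mathcal{C}_l})=\arg\min_{z\in\mathcal{D}_l}\|z-x_{\mathcal{C}_l}\|_{\mathrm{diag}(\gamma_{\mathcal{C}_l})}$.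 The clique-based projection $T:\mathbb{R}^{nd}\to\mathbb{R}^{nd}$ onto $\mathcal{D}$ is $T(x)=[T_1^\top,\ldots,T_n^\top]^\top$ with $$T_i=\frac{1}{|\mathrm{clq}_i(G)|}\sum_{l\in\mathrm{clq}_i(G)}[P_{\mathcal{D}_l}(x_{\mathcal{C}_l})]_{m_{l,i}},$$ where $m_{l,i}$ is the position of $i$ in the increasing ordering of $\mathcal{C}_l$ and $[v]_j\in\mathbb{R}^d$ is the $j$th $d$-dimensional block of $v$. *)

theory Defs
  imports "HOL-Analysis.Analysis"
begin

text \<open>
  The vertex set \<open>\<N> = {1,\<dots>,n}\<close> is the finite type \<open>'n\<close>, and \<open>\<real>\<^sup>n\<^sup>d\<close> is \<open>real ^ 'd ^ 'n\<close>: the block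
  \<open>x\<^sub>i\<close> is \<open>x $ i\<close>, and the library's \<open>norm\<close> on this type is the Euclidean norm of all \<open>nd\<close>
  coordinates.  A graph is given by its adjacency relation \<open>E\<close>, assumed symmetric;
  loops, if any, play no role.
\<close>

definition clique :: "('n \<times> 'n) set \<Rightarrow> 'n set \<Rightarrow> bool" where
  "clique E K \<longleftrightarrow> (\<forall>i\<in>K. \<forall>j\<in>K. i \<noteq> j \<longrightarrow> (i, j) \<in> E)"

definition maximal_clique :: "('n \<times> 'n) set \<Rightarrow> 'n set \<Rightarrow> bool" where
  "maximal_clique E K \<longleftrightarrow> clique E K \<and> (\<nexists>K'. clique E K' \<and> K \<subset> K')"

text \<open>
  The maximal cliques are \<open>C 1, \<dots>, C q\<close>, and \<open>clq\<^sub>i(G)\<close> is \<open>clq_at C q i\<close>.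
\<close>

definition clq_at :: "(nat \<Rightarrow> 'n set) \<Rightarrow> nat \<Rightarrow> 'n \<Rightarrow> nat set" where
  "clq_at C q i = {l \<in> {1..q}. i \<in> C l}"

text \<open>
  The dimension of \<open>\<real>\<^bsup>|K|d\<^esup>\<close> depends on the clique \<open>K\<close>, so it cannot be a type of its own.  It is
  identified with the subspace of vectors whose blocks outside \<open>K\<close> vanish, the blocks
  being labelled by the vertices of \<open>K\<close> instead of by their positions in the increasing
  ordering of \<open>K\<close>.  Thus the block of \<open>v\<close> at the position of \<open>i\<close> in \<open>K\<close> is \<open>v $ i\<close>.  This
  identification is a linear isometry onto a closed subspace, so closedness, convexity, inner
  products and norms agree with those of \<open>\<real>\<^bsup>|K|d\<^esup>\<close>.
\<close>

definition block_space :: "'n::finite set \<Rightarrow> (real ^ 'd ^ 'n) set" where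
  "block_space K = {v. \<forall>i. i \<notin> K \<longrightarrow> v $ i = 0}"

definition subvec :: "'n::finite set \<Rightarrow> real ^ 'd ^ 'n \<Rightarrow> real ^ 'd ^ 'n" where
  "subvec K x = (\<chi> i. if i \<in> K then x $ i else 0)"

text \<open>A square matrix \<open>Q\<close> acting on block vectors is given as the map \<open>v \<mapsto> Q v\<close>.\<close>

definition qnorm :: "(real ^ 'd ^ 'n \<Rightarrow> real ^ 'd ^ 'n) \<Rightarrow> real ^ 'd ^ 'n \<Rightarrow> real" where
  "qnorm Q v = sqrt (v \<bullet> Q v)"

definition diag_op :: "real ^ 'd ^ 'n \<Rightarrow> real ^ 'd ^ 'n \<Rightarrow> real ^ 'd ^ 'n" where
  "diag_op g v = (\<chi> i j. g $ i $ j * v $ i $ j)"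

definition clq_gamma :: "(nat \<Rightarrow> 'n set) \<Rightarrow> nat \<Rightarrow> real ^ 'd ^ 'n" where
  "clq_gamma C q = (\<chi> i j. 1 / real (card (clq_at C q i)))"

definition clq_proj ::
    "(nat \<Rightarrow> 'n set) \<Rightarrow> nat \<Rightarrow> (nat \<Rightarrow> (real ^ 'd ^ 'n) set) \<Rightarrow> nat \<Rightarrow> real ^ 'd ^ 'n \<Rightarrow> real ^ 'd ^ 'n" where
  "clq_proj C q D l y =
     (ARG_MIN (\<lambda>z. qnorm (diag_op (subvec (C l) (clq_gamma C q))) (z - y)) z. z \<in> D l)"

definition clq_T ::
    "(nat \<Rightarrow> 'n set) \<Rightarrow> nat \<Rightarrow> (nat \<Rightarrow> (real ^ 'd ^ 'n) set) \<Rightarrow> real ^ 'd ^ 'n \<Rightarrow> real ^ 'd ^ 'n" where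
  "clq_T C q D x =
     (\<chi> i. (1 / real (card (clq_at C q i))) *\<^sub>R
            (\<Sum>l\<in>clq_at C q i. clq_proj C q D l (subvec (C l) x) $ i))"

definition clq_set ::
    "(nat \<Rightarrow> 'n set) \<Rightarrow> nat \<Rightarrow> (nat \<Rightarrow> (real ^ 'd ^ 'n) set) \<Rightarrow> (real ^ 'd ^ 'n) set" where
  "clq_set C q D = (\<Inter>l\<in>{1..q}. {x. subvec (C l) x \<in> D l})"

end

theory Submission
  imports Defs
begin

text \<open>
  The map \<open>T\<close> is an orthogonal projection seen through an isometry.  Put \<open>w\<^sub>i = 1 / |clq\<^sub>i(G)|\<close> and
  send \<open>x\<close> to the family of its restrictions to the maximal cliques, with the block of each vertex
  \<open>i\<close> scaled by the square root of \<open>w\<^sub>i\<close>.  Vertex \<open>i\<close> occurs in exactly \<open>1 / w\<^sub>i\<close> of the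
  cliques, so this linear map \<open>A\<close> preserves the norm (lemma \<open>clique_energy\<close>).  It turns the weighted projections into Euclidean ones, acting
  independently on the cliques, and the averaging in \<open>T\<close> is the adjoint of \<open>A\<close>.  Therefore
  \<open>T = A\<^sup>* P A\<close> with \<open>P\<close> a Euclidean projection.

  Projections are firmly nonexpansive (lemma \<open>closest_point_firmly_nonexpansive\<close>) and
  \<open>A\<^sup>*\<close> does not increase the norm (lemma \<open>norm_average_le_clique_energy\<close>, which is Jensen's
  inequality at each vertex).  Together they give, for all \<open>x\<close> and \<open>y\<close>,
  \<open>\<parallel>T x - T y\<parallel>\<^sup>2 + \<parallel>(A x - P A x) - (A y - P A y)\<parallel>\<^sup>2 \<le> \<parallel>x - y\<parallel>\<^sup>2\<close>.
  Nonexpansiveness is immediate.  When \<open>y = z\<close> lies in \<open>\<D>\<close>, both \<open>T z = z\<close> and \<open>P A z = A z\<close>, and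
  the second term becomes the squared distance from \<open>A x\<close> to its projection, which vanishes only
  for \<open>x \<in> \<D>\<close>.  This yields the strict decrease (c), and (c) excludes fixed points outside \<open>\<D>\<close>.

  Convergence of the iterates needs nothing more than (a), (b) and (c): in finite dimension it holds
  for every nonexpansive map that has fixed points and strictly decreases the distance from any
  other point to each of them
  (lemma \<open>iterates_converge_to_attracting_fixed_point\<close>).
\<close>

section \<open>Iterating a map that is attracted by its fixed points\<close>

text \<open>
  The distances of the orbit to a point \<open>z\<close> of \<open>S\<close> decrease to some \<open>c\<close>.  A cluster point \<open>a\<close> of
  the orbit has distance \<open>c\<close> from \<open>z\<close>, and so does its image, since the image is a cluster point as
  well; strict decrease then forces \<open>a \<in> S\<close>.  Now the distances to \<open>a\<close> itself decrease, and they
  tend to \<open>0\<close> along a subsequence, hence altogether.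
\<close>

lemma iterates_converge_to_attracting_fixed_point:
  fixes f :: "'a::heine_borel \<Rightarrow> 'a"
  assumes nonexp: "\<And>x y. dist (f x) (f y) \<le> dist x y"
    and fixed: "\<And>z. z \<in> S \<Longrightarrow> f z = z"
    and attr: "\<And>x z. x \<notin> S \<Longrightarrow> z \<in> S \<Longrightarrow> dist (f x) z < dist x z"
    and "S \<noteq> {}"
  shows "\<exists>a\<in>S. (\<lambda>p. (f ^^ p) x) \<longlonglongrightarrow> a"
proof -
  define X where "X p = (f ^^ p) x" for p
  have X_Suc: "X (Suc p) = f (X p)" for p
    by (simp add: X_def)
  have decr: "decseq (\<lambda>p. dist (X p) z)" if "z \<in> S" for z
    using nonexp[of _ z] fixed[OF that] by (intro decseq_SucI) (simp add: X_Suc)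
  obtain z where z: "z \<in> S"
    using \<open>S \<noteq> {}\<close> by blast
  obtain c where c: "(\<lambda>p. dist (X p) z) \<longlonglongrightarrow> c"
    using decseq_convergent[OF decr[OF z], of 0] by auto
  have "range X \<subseteq> cball z (dist (X 0) z)"
    using decseqD[OF decr[OF z], of 0] by (auto simp: dist_commute)
  then have "bounded (range X)"
    using bounded_subset bounded_cball by blast
  then obtain a r where r: "strict_mono (r :: nat \<Rightarrow> nat)" and a: "(X \<circ> r) \<longlonglongrightarrow> a"
    using bounded_imp_convergent_subsequence by blast
  have "(\<lambda>p. dist (X (r p)) z) \<longlonglongrightarrow> dist a z"
    using tendsto_dist[OF a tendsto_const] by (simp add: o_def)
  moreover have "(\<lambda>p. dist (X (r p)) z) \<longlonglongrightarrow> c"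
    using LIMSEQ_subseq_LIMSEQ[OF c r] by (simp add: o_def)
  ultimately have az: "dist a z = c"
    by (rule LIMSEQ_unique)
  have "(\<lambda>p. dist (f (X (r p))) (f a)) \<longlonglongrightarrow> 0"
  proof (rule tendsto_sandwich[OF _ _ tendsto_const])
    show "(\<lambda>p. dist (X (r p)) a) \<longlonglongrightarrow> 0"
      using a by (simp add: o_def tendsto_dist_iff[symmetric])
  qed (simp_all add: nonexp)
  then have "(\<lambda>p. X (Suc (r p))) \<longlonglongrightarrow> f a"
    by (simp add: X_Suc tendsto_dist_iff[symmetric])
  then have "(\<lambda>p. dist (X (Suc (r p))) z) \<longlonglongrightarrow> dist (f a) z"
    by (intro tendsto_dist tendsto_const)
  moreover have "(\<lambda>p. dist (X (Suc (r p))) z) \<longlonglongrightarrow> c"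
    using LIMSEQ_subseq_LIMSEQ[OF LIMSEQ_Suc[OF c] r] by (simp add: o_def)
  ultimately have "dist (f a) z = c"
    by (rule LIMSEQ_unique)
  then have aS: "a \<in> S"
    using attr[OF _ z, of a] az by (metis less_irrefl)
  obtain b where b: "(\<lambda>p. dist (X p) a) \<longlonglongrightarrow> b"
    using decseq_convergent[OF decr[OF aS], of 0] by auto
  have "(\<lambda>p. dist (X (r p)) a) \<longlonglongrightarrow> b"
    using LIMSEQ_subseq_LIMSEQ[OF b r] by (simp add: o_def)
  moreover have "(\<lambda>p. dist (X (r p)) a) \<longlonglongrightarrow> 0"
    using a by (simp add: o_def tendsto_dist_iff[symmetric])
  ultimately have "b = 0"
    by (rule LIMSEQ_unique)
  then have "X \<longlonglongrightarrow> a"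
    using b by (simp add: tendsto_dist_iff[symmetric])
  then show ?thesis
    using aS unfolding X_def by (rule bexI)
qed

section \<open>Euclidean projections and averages\<close>

text \<open>
  By convexity the segment from \<open>p\<close> to \<open>p'\<close> stays in \<open>S\<close>, so the angles at \<open>p\<close> between \<open>x\<close> and
  \<open>p'\<close> and at \<open>p'\<close> between \<open>x'\<close> and \<open>p\<close> are not acute.  The sum of the two corresponding inequalities bounds \<open>\<parallel>p - p'\<parallel>\<^sup>2\<close> by \<open>(x - x') \<bullet> (p - p')\<close>, and this is
  the claim after expanding the square.
\<close>

lemma closest_point_firmly_nonexpansive:
  fixes S :: "'a::euclidean_space set"
  assumes "convex S" "closed S"
    and "p \<in> S" "\<And>u. u \<in> S \<Longrightarrow> dist x p \<le> dist x u"
    and "p' \<in> S" "\<And>u. u \<in> S \<Longrightarrow> dist x' p' \<le> dist x' u"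
  shows "(norm (p - p'))\<^sup>2 + (norm ((x - p) - (x' - p')))\<^sup>2 \<le> (norm (x - x'))\<^sup>2"
proof -
  have "(x - p) \<bullet> (p' - p) \<le> 0" "(x' - p') \<bullet> (p - p') \<le> 0"
    using assms by (auto intro!: any_closest_point_dot)
  then show ?thesis
    unfolding power2_norm_eq_inner by (simp add: inner_commute algebra_simps)
qed

lemma norm_average_squared_le:
  fixes f :: "'b \<Rightarrow> 'a::real_normed_vector"
  shows "(norm ((1 / real (card A)) *\<^sub>R (\<Sum>l\<in>A. f l)))\<^sup>2
         \<le> (1 / real (card A)) * (\<Sum>l\<in>A. (norm (f l))\<^sup>2)"
proof (cases "card A = 0")
  case False
  have "(norm (\<Sum>l\<in>A. f l))\<^sup>2 \<le> (\<Sum>l\<in>A. norm (f l))\<^sup>2"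
    by (intro power_mono norm_sum) simp
  also have "\<dots> \<le> (\<Sum>l\<in>A. (norm (f l))\<^sup>2) * real (card A)"
    by (rule sum_squared_le_sum_of_squares)
  finally show ?thesis
    using False by (simp add: power2_eq_square field_simps)
qed auto

lemma norm_squared_vec: "(norm x)\<^sup>2 = (\<Sum>i\<in>UNIV. (norm (x $ i))\<^sup>2)"
  for x :: "'a::real_inner ^ 'n::finite"
  by (simp add: power2_norm_eq_inner inner_vec_def)

section \<open>Maximal cliques cover the graph\<close>

lemma clique_subset_maximal_clique:
  fixes E :: "('n::finite \<times> 'n) set"
  assumes "clique E K"
  obtains M where "maximal_clique E M" "K \<subseteq> M"
  using finite_has_maximal2[of "{K. clique E K}" K] assms
  unfolding maximal_clique_def by auto

lemma maximal_cliques_cover: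
  fixes E :: "('n::finite \<times> 'n) set"
  assumes "C ` I = {K. maximal_clique E K}"
  shows "\<exists>l\<in>I. i \<in> C l"
proof -
  have "clique E {i}"
    by (simp add: clique_def)
  then obtain M where "maximal_clique E M" "{i} \<subseteq> M"
    by (rule clique_subset_maximal_clique)
  with assms show ?thesis
    by (metis imageE insert_subset mem_Collect_eq)
qed

section \<open>The weighted geometry of a cover\<close>

text \<open>
  The norm identities rest on every vertex lying in some \<open>C l\<close>, which makes its weight the reciprocal
  of a positive number.  They are therefore stated for an arbitrary finite cover of the vertices.
\<close>

locale block_cover =
  fixes C :: "nat \<Rightarrow> 'n::finite set" and q :: nat and D :: "nat \<Rightarrow> (real ^ 'd::finite ^ 'n) set"
  assumes cover: "\<exists>l\<in>{1..q}. i \<in> C l"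
    and D_subset: "l \<in> {1..q} \<Longrightarrow> D l \<subseteq> block_space (C l)"
    and D_nonempty: "l \<in> {1..q} \<Longrightarrow> D l \<noteq> {}"
    and D_closed: "l \<in> {1..q} \<Longrightarrow> closed (D l)"
    and D_convex: "l \<in> {1..q} \<Longrightarrow> convex (D l)"
begin

definition weight :: "'n \<Rightarrow> real" where
  "weight i = 1 / real (card (clq_at C q i))"

text \<open>
  The square root of the matrix \<open>diag(\<gamma>)\<close>: it carries the weighted norm to the Euclidean norm.
\<close>

definition rescale :: "real ^ 'd ^ 'n \<Rightarrow> real ^ 'd ^ 'n" where
  "rescale x = (\<chi> i. sqrt (weight i) *\<^sub>R x $ i)"

lemma card_clq_at_pos: "card (clq_at C q i) > 0"
  using cover[of i] by (auto simp: clq_at_def card_gt_0_iff)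

lemma weight_pos: "weight i > 0"
  using card_clq_at_pos by (simp add: weight_def)

lemma linear_rescale: "linear rescale"
  by (rule linearI) (simp_all add: rescale_def vec_eq_iff algebra_simps)

lemma inj_rescale: "inj rescale"
  using weight_pos by (intro injI) (simp add: rescale_def vec_eq_iff less_imp_neq[symmetric])

lemma norm_rescale_squared: "(norm (rescale x))\<^sup>2 = (\<Sum>i\<in>UNIV. weight i * (norm (x $ i))\<^sup>2)"
  using weight_pos
  by (simp add: norm_squared_vec rescale_def power_mult_distrib less_imp_le)

lemma qnorm_clq_gamma_eq:
  assumes "v \<in> block_space (C l)"
  shows "qnorm (diag_op (subvec (C l) (clq_gamma C q))) v = norm (rescale v)"
proof -
  have "v $ i \<bullet> diag_op (subvec (C l) (clq_gamma C q)) v $ i = weight i * (norm (v $ i))\<^sup>2" for i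
    using assms
    by (cases "i \<in> C l")
      (simp_all add: block_space_def diag_op_def subvec_def clq_gamma_def weight_def
        power2_norm_eq_inner inner_vec_def sum_divide_distrib)
  then have "v \<bullet> diag_op (subvec (C l) (clq_gamma C q)) v = (norm (rescale v))\<^sup>2"
    by (simp add: norm_rescale_squared inner_vec_def[of v])
  then show ?thesis
    by (simp add: qnorm_def)
qed

lemma subvec_in_block_space: "subvec K x \<in> block_space K"
  by (simp add: subvec_def block_space_def)

lemma subvec_diff: "subvec K (x - y) = subvec K x - subvec K y"
  by (simp add: subvec_def vec_eq_iff)

lemma block_space_diff: "u \<in> block_space K \<Longrightarrow> v \<in> block_space K \<Longrightarrow> u - v \<in> block_space K"
  by (simp add: block_space_def)

text \<open>
  Double counting of the pairs \<open>(l, i)\<close> with \<open>i \<in> C l\<close>: the restriction to a clique contributes only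
  at its own vertices.
\<close>

lemma sum_norm_rescale_squared:
  assumes "\<And>l. l \<in> {1..q} \<Longrightarrow> u l \<in> block_space (C l)"
  shows "(\<Sum>l\<in>{1..q}. (norm (rescale (u l)))\<^sup>2) =
         (\<Sum>i\<in>UNIV. weight i * (\<Sum>l\<in>clq_at C q i. (norm (u l $ i))\<^sup>2))"
proof -
  have "(\<Sum>l\<in>{1..q}. (norm (rescale (u l)))\<^sup>2) =
        (\<Sum>i\<in>UNIV. weight i * (\<Sum>l\<in>{1..q}. (norm (u l $ i))\<^sup>2))"
    unfolding norm_rescale_squared by (subst sum.swap) (simp add: sum_distrib_left)
  moreover have "(\<Sum>l\<in>{1..q}. (norm (u l $ i))\<^sup>2) = (\<Sum>l\<in>clq_at C q i. (norm (u l $ i))\<^sup>2)" for i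
    using assms by (intro sum.mono_neutral_right) (auto simp: clq_at_def block_space_def)
  ultimately show ?thesis
    by simp
qed

text \<open>
  The embedding of a vector as the family of its rescaled restrictions is an isometry, because the
  weight of a vertex is the reciprocal of the number of cliques that contain it.
\<close>

lemma clique_energy: "(\<Sum>l\<in>{1..q}. (norm (rescale (subvec (C l) x)))\<^sup>2) = (norm x)\<^sup>2"
proof -
  have "weight i * (\<Sum>l\<in>clq_at C q i. (norm (subvec (C l) x $ i))\<^sup>2) = (norm (x $ i))\<^sup>2" for i
  proof -
    have "(\<Sum>l\<in>clq_at C q i. (norm (subvec (C l) x $ i))\<^sup>2) =
          real (card (clq_at C q i)) * (norm (x $ i))\<^sup>2"
      by (simp add: clq_at_def subvec_def)
    then show ?thesis
      using card_clq_at_pos[of i] by (simp add: weight_def)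
  qed
  then show ?thesis
    unfolding sum_norm_rescale_squared[OF subvec_in_block_space] norm_squared_vec[of x] by simp
qed

text \<open>
  Averaging over the cliques at each vertex is the adjoint of that isometry, so it cannot increase
  the norm.
\<close>

lemma norm_average_le_clique_energy:
  assumes "\<And>l. l \<in> {1..q} \<Longrightarrow> u l \<in> block_space (C l)"
  shows "(norm (\<chi> i. weight i *\<^sub>R (\<Sum>l\<in>clq_at C q i. u l $ i)))\<^sup>2
         \<le> (\<Sum>l\<in>{1..q}. (norm (rescale (u l)))\<^sup>2)"
proof -
  have "(\<Sum>i\<in>UNIV. (norm (weight i *\<^sub>R (\<Sum>l\<in>clq_at C q i. u l $ i)))\<^sup>2)
        \<le> (\<Sum>i\<in>UNIV. weight i * (\<Sum>l\<in>clq_at C q i. (norm (u l $ i))\<^sup>2))"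
    unfolding weight_def by (intro sum_mono norm_average_squared_le)
  then show ?thesis
    by (simp only: norm_squared_vec[of "vec_lambda _"] vec_lambda_beta
        sum_norm_rescale_squared[OF assms])
qed

section \<open>The clique-based projection\<close>

definition local_proj :: "nat \<Rightarrow> real ^ 'd ^ 'n \<Rightarrow> real ^ 'd ^ 'n" where
  "local_proj l x = clq_proj C q D l (subvec (C l) x)"

lemma convex_rescale_D: "l \<in> {1..q} \<Longrightarrow> convex (rescale ` D l)"
  by (intro convex_linear_image linear_rescale D_convex)

lemma closed_rescale_D: "l \<in> {1..q} \<Longrightarrow> closed (rescale ` D l)"
  by (intro closed_injective_linear_image linear_rescale inj_rescale D_closed)

text \<open>
  A closest point of the closed set \<open>rescale ` D l\<close> shows that the weighted distance has a
  minimiser, so the choice in the definition of the projection picks one.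
\<close>

lemma
  assumes l: "l \<in> {1..q}"
  shows local_proj_in_D: "local_proj l x \<in> D l"
    and local_proj_minimal: "u \<in> D l \<Longrightarrow>
      dist (rescale (subvec (C l) x)) (rescale (local_proj l x))
        \<le> dist (rescale (subvec (C l) x)) (rescale u)"
proof -
  define y where "y = subvec (C l) x"
  define F where "F v = qnorm (diag_op (subvec (C l) (clq_gamma C q))) (v - y)" for v
  have F_eq: "F v = dist (rescale y) (rescale v)" if "v \<in> D l" for v
  proof -
    have "v - y \<in> block_space (C l)"
      using that D_subset[OF l] by (auto simp: y_def intro!: block_space_diff subvec_in_block_space)
    then show ?thesis
      by (simp add: F_def qnorm_clq_gamma_eq linear_diff[OF linear_rescale] dist_norm
          norm_minus_commute)
  qed
  have "rescale ` D l \<noteq> {}"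
    using D_nonempty[OF l] by simp
  then obtain w where w: "w \<in> rescale ` D l"
      and w_min: "\<And>u. u \<in> rescale ` D l \<Longrightarrow> dist (rescale y) w \<le> dist (rescale y) u"
    using distance_attains_inf[OF closed_rescale_D[OF l], of "rescale y"] by metis
  then obtain v where v: "v \<in> D l" and "w = rescale v"
    by blast
  then have v_min: "dist (rescale y) (rescale v) \<le> dist (rescale y) (rescale u)" if "u \<in> D l" for u
    using w_min that by simp
  have "is_arg_min F (\<lambda>v. v \<in> D l) v"
    using v v_min by (auto simp: is_arg_min_linorder F_eq)
  then have "is_arg_min F (\<lambda>v. v \<in> D l) (arg_min F (\<lambda>v. v \<in> D l))"
    unfolding arg_min_def by (rule someI)
  moreover have "local_proj l x = arg_min F (\<lambda>v. v \<in> D l)"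
    by (simp add: local_proj_def clq_proj_def F_def[abs_def] y_def)
  ultimately have arg_min: "is_arg_min F (\<lambda>v. v \<in> D l) (local_proj l x)"
    by simp
  then show "local_proj l x \<in> D l"
    by (simp add: is_arg_min_def)
  then show "dist (rescale (subvec (C l) x)) (rescale (local_proj l x))
      \<le> dist (rescale (subvec (C l) x)) (rescale u)" if "u \<in> D l"
    using arg_min that by (simp add: is_arg_min_linorder F_eq y_def)
qed

lemma local_proj_in_block_space: "l \<in> {1..q} \<Longrightarrow> local_proj l x \<in> block_space (C l)"
  using local_proj_in_D D_subset by blast

lemma local_proj_eq:
  assumes "l \<in> {1..q}" "subvec (C l) x \<in> D l"
  shows "local_proj l x = subvec (C l) x"
  using local_proj_minimal[OF assms, of x] inj_rescale by (simp add: inj_eq)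

lemma local_proj_firmly_nonexpansive:
  assumes l: "l \<in> {1..q}"
  shows "(norm (rescale (local_proj l x - local_proj l y)))\<^sup>2 +
         (norm (rescale ((subvec (C l) x - local_proj l x) - (subvec (C l) y - local_proj l y))))\<^sup>2
         \<le> (norm (rescale (subvec (C l) (x - y))))\<^sup>2"
  using closest_point_firmly_nonexpansive[OF convex_rescale_D[OF l] closed_rescale_D[OF l],
      of "rescale (local_proj l x)" "rescale (subvec (C l) x)"
         "rescale (local_proj l y)" "rescale (subvec (C l) y)"]
    local_proj_in_D[OF l] local_proj_minimal[OF l]
  by (auto simp: linear_diff[OF linear_rescale] subvec_diff)

lemma clq_T_eq: "clq_T C q D x = (\<chi> i. weight i *\<^sub>R (\<Sum>l\<in>clq_at C q i. local_proj l x $ i))"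
  by (simp add: clq_T_def weight_def local_proj_def)

text \<open>
  The isometry, the firm nonexpansiveness of the clique projections and the contraction of the
  averaging combine into the inequality from which all the properties of \<open>T\<close> follow.
\<close>

lemma clq_T_firm_inequality:
  "(norm (clq_T C q D x - clq_T C q D y))\<^sup>2 +
   (\<Sum>l\<in>{1..q}.
     (norm (rescale ((subvec (C l) x - local_proj l x) - (subvec (C l) y - local_proj l y))))\<^sup>2)
   \<le> (norm (x - y))\<^sup>2"
proof -
  have "clq_T C q D x - clq_T C q D y =
        (\<chi> i. weight i *\<^sub>R (\<Sum>l\<in>clq_at C q i. (local_proj l x - local_proj l y) $ i))"
    by (simp add: clq_T_eq vec_eq_iff sum_subtractf algebra_simps)
  then have "(norm (clq_T C q D x - clq_T C q D y))\<^sup>2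
      \<le> (\<Sum>l\<in>{1..q}. (norm (rescale (local_proj l x - local_proj l y)))\<^sup>2)"
    using norm_average_le_clique_energy[of "\<lambda>l. local_proj l x - local_proj l y"]
    by (simp add: block_space_diff local_proj_in_block_space)
  moreover have "(\<Sum>l\<in>{1..q}. (norm (rescale (local_proj l x - local_proj l y)))\<^sup>2 +
      (norm (rescale ((subvec (C l) x - local_proj l x) - (subvec (C l) y - local_proj l y))))\<^sup>2)
      \<le> (\<Sum>l\<in>{1..q}. (norm (rescale (subvec (C l) (x - y))))\<^sup>2)"
    by (intro sum_mono local_proj_firmly_nonexpansive)
  ultimately show ?thesis
    by (simp only: clique_energy sum.distrib)
qed

lemma clq_T_nonexpansive: "norm (clq_T C q D x - clq_T C q D y) \<le> norm (x - y)"
proof (rule power2_le_imp_le)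
  show "(norm (clq_T C q D x - clq_T C q D y))\<^sup>2 \<le> (norm (x - y))\<^sup>2"
    by (rule order_trans[OF _ clq_T_firm_inequality]) (simp add: sum_nonneg)
qed simp

lemma clq_T_fixes_clq_set:
  assumes "z \<in> clq_set C q D"
  shows "clq_T C q D z = z"
proof -
  have "local_proj l z $ i = z $ i" if "l \<in> clq_at C q i" for l i
    using that assms local_proj_eq[of l z] by (auto simp: clq_at_def clq_set_def subvec_def)
  then show ?thesis
    using card_clq_at_pos by (simp add: clq_T_eq vec_eq_iff weight_def less_imp_neq[symmetric])
qed

text \<open>
  A point outside \<open>\<D>\<close> is moved by the projection of at least one clique, and the displacement there
  is lost from the distance to \<open>z\<close>.
\<close>

lemma clq_T_strictly_closer:
  assumes x: "x \<notin> clq_set C q D" and z: "z \<in> clq_set C q D"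
  shows "norm (clq_T C q D x - z) < norm (x - z)"
proof (rule power2_less_imp_less)
  obtain k where k: "k \<in> {1..q}" and "subvec (C k) x \<notin> D k"
    using x by (auto simp: clq_set_def)
  then have "subvec (C k) x - local_proj k x \<noteq> 0"
    using local_proj_in_D[OF k, of x] by auto
  then have "rescale (subvec (C k) x - local_proj k x) \<noteq> 0"
    using linear_inj_on_iff_eq_0[OF linear_rescale, of UNIV] inj_rescale by auto
  then have "0 < (norm (rescale (subvec (C k) x - local_proj k x)))\<^sup>2"
    by simp
  also have "\<dots> \<le> (\<Sum>l\<in>{1..q}. (norm (rescale (subvec (C l) x - local_proj l x)))\<^sup>2)"
    using k by (intro member_le_sum) auto
  also have "\<dots> = (\<Sum>l\<in>{1..q}.
      (norm (rescale ((subvec (C l) x - local_proj l x) - (subvec (C l) z - local_proj l z))))\<^sup>2)"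
    using z by (intro sum.cong) (auto simp: clq_set_def local_proj_eq)
  finally show "(norm (clq_T C q D x - z))\<^sup>2 < (norm (x - z))\<^sup>2"
    using clq_T_firm_inequality[of x z] by (simp add: clq_T_fixes_clq_set[OF z])
qed simp

end

section \<open>Properties of the clique-based projection\<close>

theorem lemma6:
  fixes E :: "('n::finite \<times> 'n) set"
    and C :: "nat \<Rightarrow> 'n set"
    and q :: nat
    and D :: "nat \<Rightarrow> (real ^ 'd ^ 'n) set"
  assumes "sym E"
    and "bij_betw C {1..q} {K. maximal_clique E K}"
    and "\<And>l. l \<in> {1..q} \<Longrightarrow>
           D l \<subseteq> block_space (C l) \<and> D l \<noteq> {} \<and> closed (D l) \<and> convex (D l)"
    and "clq_set C q D \<noteq> {}" and "closed (clq_set C q D)" and "convex (clq_set C q D)"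
  shows "(\<forall>x y. norm (clq_T C q D x - clq_T C q D y) \<le> norm (x - y)) \<and>
         {x. clq_T C q D x = x} = clq_set C q D \<and>
         (\<forall>x z. x \<notin> clq_set C q D \<longrightarrow> z \<in> clq_set C q D \<longrightarrow>
            norm (clq_T C q D x - z) < norm (x - z)) \<and>
         (\<forall>x. convergent (\<lambda>p. (clq_T C q D ^^ p) x) \<and>
            lim (\<lambda>p. (clq_T C q D ^^ p) x) \<in> clq_set C q D)"
proof -
  interpret block_cover C q D
  proof
    show "\<exists>l\<in>{1..q}. i \<in> C l" for i
      by (rule maximal_cliques_cover[OF bij_betw_imp_surj_on[OF assms(2)]])
  qed (use assms(3) in simp_all)
  have fixed_points: "{x. clq_T C q D x = x} = clq_set C q D"
  proof
    show "clq_set C q D \<subseteq> {x. clq_T C q D x = x}"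
      using clq_T_fixes_clq_set by blast
    obtain z where z: "z \<in> clq_set C q D"
      using assms(4) by blast
    show "{x. clq_T C q D x = x} \<subseteq> clq_set C q D"
    proof (rule subsetI, rule ccontr)
      fix x
      assume "x \<in> {x. clq_T C q D x = x}" "x \<notin> clq_set C q D"
      then show False
        using clq_T_strictly_closer[of x z] z by simp
    qed
  qed
  have limit: "\<exists>a\<in>clq_set C q D. (\<lambda>p. (clq_T C q D ^^ p) x) \<longlonglongrightarrow> a" for x
    using assms(4)
    by (intro iterates_converge_to_attracting_fixed_point)
      (simp_all add: dist_norm clq_T_nonexpansive clq_T_fixes_clq_set clq_T_strictly_closer)
  have "convergent (\<lambda>p. (clq_T C q D ^^ p) x) \<and>
        lim (\<lambda>p. (clq_T C q D ^^ p) x) \<in> clq_set C q D" for x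
    using limit[of x] by (auto simp: convergent_def dest: limI)
  with fixed_points show ?thesis
    using clq_T_nonexpansive clq_T_strictly_closer by blast
qed

end
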